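(* Suppose $p_i=n^{-\alpha_i}$ with $\alpha_i\ge 0$, such that there exists $r\in\mathbb{N}$ with $p_j=0$ for all $j>r$. Then the random simplicial complex $\overline{X}(n;p_1,p_2,\ldots)$ asymptotically almost surely collapses onto dimension $l=\lfloor \max_i (i+1-\alpha_i)\rfloor$.
   Context: Upper multiparametric model: let $H$ be the random hypergraph on $n$ vertices in which, for every $i\ge 1$, each $i$-dimensional face (subset of size $i+1$ of the vertices) is chosen independently with probability $p_i$. $\overline{X}(n;p_1,p_2,\ldots)$ is the distribution of the minimal simplicial complex containing $H$. The $\alpha_i$ are fixed real numbers not depending on $n$, and the maximum defining $l$ is over those $i\le r$ for which $p_i=n^{-\alpha_i}$ (indices with $p_j=0$ correspond to $\alpha_j=\infty$ and do not contribute). A property holds asymptotically almost surely (a.a.s.) if its probability tends to $1$ as $n\to\infty$. Collapses: in a simplicial complex $C$, let $\sigma\subset\tau$ be faces such that $\sigma$ is a codimension-one face of $\tau$ and no simplex other than $\tau$ properly contains $\sigma$ (then $\sigma$ is called a free face). Erasing both $\sigma$ and $\tau$ from the complex is an elementary collapse. $C$ collapses onto dimension $d$ if there is a series of elementary collapses starting with $C$ and resulting in a simplicial complex with only simplices of dimension $d$ or lower. *)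

theory Defs
  imports "HOL-Probability.Probability" "HOL.Hull"
begin

text \<open>
  Abstract simplicial complexes are families of nonempty finite sets; the empty set is not
  counted as a simplex.
\<close>

definition simplicial_complex :: "'a set set \<Rightarrow> bool" where
  "simplicial_complex K \<longleftrightarrow>
     (\<forall>\<sigma>\<in>K. finite \<sigma> \<and> \<sigma> \<noteq> {}) \<and>
     (\<forall>\<tau>\<in>K. \<forall>\<sigma>. \<sigma> \<noteq> {} \<and> \<sigma> \<subseteq> \<tau> \<longrightarrow> \<sigma> \<in> K)"

definition face_dim :: "'a set \<Rightarrow> int" where
  "face_dim \<sigma> = int (card \<sigma>) - 1"

definition free_face :: "'a set set \<Rightarrow> 'a set \<Rightarrow> 'a set \<Rightarrow> bool" where
  "free_face C \<sigma> \<tau> \<longleftrightarrow>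
     \<sigma> \<in> C \<and> \<tau> \<in> C \<and> \<sigma> \<subset> \<tau> \<and> face_dim \<tau> = face_dim \<sigma> + 1 \<and>
     (\<forall>\<rho>\<in>C. \<sigma> \<subset> \<rho> \<longrightarrow> \<rho> = \<tau>)"

definition elementary_collapse :: "'a set set \<Rightarrow> 'a set set \<Rightarrow> bool" where
  "elementary_collapse C D \<longleftrightarrow> (\<exists>\<sigma> \<tau>. free_face C \<sigma> \<tau> \<and> D = C - {\<sigma>, \<tau>})"

definition collapses_onto_dim :: "'a set set \<Rightarrow> int \<Rightarrow> bool" where
  "collapses_onto_dim C d \<longleftrightarrow>
     (\<exists>D. elementary_collapse\<^sup>*\<^sup>* C D \<and> simplicial_complex D \<and> (\<forall>\<sigma>\<in>D. face_dim \<sigma> \<le> d))"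

definition possible_faces :: "nat \<Rightarrow> nat set set" where
  "possible_faces n = {\<sigma>. \<sigma> \<subseteq> {..<n} \<and> face_dim \<sigma> \<ge> 1}"

definition random_hypergraph :: "nat \<Rightarrow> (nat \<Rightarrow> real) \<Rightarrow> nat set set pmf" where
  "random_hypergraph n p =
     map_pmf (\<lambda>chosen. {\<sigma> \<in> possible_faces n. chosen \<sigma>})
       (Pi_pmf (possible_faces n) False (\<lambda>\<sigma>. bernoulli_pmf (p (nat (face_dim \<sigma>)))))"

text \<open>
  The upper model: \<^term>\<open>simplicial_complex hull H\<close> is the intersection of all simplicial
  complexes containing \<open>H\<close>. A vertex of \<open>{..<n}\<close> lying in no hyperedge of \<open>H\<close> is not a simplex
  of it.
\<close>

definition upper_complex :: "nat \<Rightarrow> (nat \<Rightarrow> real) \<Rightarrow> nat set set pmf" where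
  "upper_complex n p = map_pmf (\<lambda>H. simplicial_complex hull H) (random_hypergraph n p)"

definition asymptotically_almost_surely :: "(nat \<Rightarrow> 'a pmf) \<Rightarrow> ('a \<Rightarrow> bool) \<Rightarrow> bool" where
  "asymptotically_almost_surely M P \<longleftrightarrow>
     (\<lambda>n. measure_pmf.prob (M n) {x. P x}) \<longlonglongrightarrow> 1"

end

theory Submission imports Defs begin

text \<open>
  With \<open>m = l + 1\<close>, an edge \<open>e\<close> has probability at most \<open>n powr - (card e - m + \<epsilon>)\<close>. Call two edges
  adjacent if they share at least \<open>m\<close> vertices: faces of dimension at least \<open>l\<close> in different
  components do not interact, so components may be collapsed separately. By the first moment method
  a.a.s. the components of edges with more than \<open>m\<close> vertices have bounded size, and every nonempty
  family \<open>T\<close> inside one of them satisfies \<open>(\<Sum>e\<in>T. card e - m) < card (\<Union>T)\<close>.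

  Such a component collapses onto dimension \<open>l\<close> by removing a vertex \<open>v\<close>: collapse the link of \<open>v\<close>
  onto dimension \<open>l - 1\<close>, then the complex without \<open>v\<close> onto dimension \<open>l\<close>. Deleting \<open>v\<close> preserves
  the density inequality. Passing to the link preserves it with \<open>m - 1\<close> unless some family of edges
  through \<open>v\<close> is tight; submodularity shows that not every vertex can lie on all edges of a tight
  family. Restricting to free faces with at least \<open>m\<close> vertices keeps the collapses compatible.
\<close>

subsection \<open>Collapses through large free faces\<close>

definition big_free_collapse :: "nat \<Rightarrow> 'a set set \<Rightarrow> 'a set set \<Rightarrow> bool" where
  "big_free_collapse m C D \<longleftrightarrow> (\<exists>\<sigma> \<tau>. free_face C \<sigma> \<tau> \<and> m \<le> card \<sigma> \<and> D = C - {\<sigma>, \<tau>})"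

definition collapses_to_card :: "nat \<Rightarrow> 'a set set \<Rightarrow> bool" where
  "collapses_to_card m C \<longleftrightarrow>
     (\<exists>D. (big_free_collapse m)\<^sup>*\<^sup>* C D \<and> (\<forall>\<sigma>\<in>D. card \<sigma> \<le> m))"

lemma collapses_to_card_refl: "(\<And>\<sigma>. \<sigma> \<in> C \<Longrightarrow> card \<sigma> \<le> m) \<Longrightarrow> collapses_to_card m C"
  unfolding collapses_to_card_def by blast

lemma collapses_to_card_steps:
  "(big_free_collapse m)\<^sup>*\<^sup>* C D \<Longrightarrow> collapses_to_card m D \<Longrightarrow> collapses_to_card m C"
  unfolding collapses_to_card_def by (meson rtranclp_trans)

lemma free_face_card: "free_face C \<sigma> \<tau> \<Longrightarrow> card \<tau> = Suc (card \<sigma>)"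
  unfolding free_face_def face_dim_def by auto

text \<open>Both removed faces contain \<sigma>, and no member of \<open>Z\<close> does. So neither
  of them lies in \<open>Z\<close>, and \<open>Z\<close> adds no new coface of \<sigma>.\<close>

lemma big_free_collapse_Un:
  assumes "big_free_collapse m K D"
    and Z: "\<And>z A. z \<in> Z \<Longrightarrow> A \<in> K \<Longrightarrow> m \<le> card A \<Longrightarrow> \<not> A \<subseteq> z"
  shows "big_free_collapse m (K \<union> Z) (D \<union> Z)"
proof -
  obtain \<sigma> \<tau> where f: "free_face K \<sigma> \<tau>" and m: "m \<le> card \<sigma>" and D: "D = K - {\<sigma>, \<tau>}"
    using assms(1) unfolding big_free_collapse_def by blast
  have st: "\<sigma> \<in> K" "\<tau> \<in> K" "\<sigma> \<subset> \<tau>" using f unfolding free_face_def by auto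
  have "\<sigma> \<notin> Z" "\<tau> \<notin> Z" using Z[OF _ st(1) m] st(3) by auto
  moreover have "free_face (K \<union> Z) \<sigma> \<tau>"
    using f Z[OF _ st(1) m] unfolding free_face_def by blast
  ultimately show ?thesis using D m unfolding big_free_collapse_def by blast
qed

lemma big_free_collapse_subset: "(big_free_collapse m)\<^sup>*\<^sup>* C D \<Longrightarrow> D \<subseteq> C"
  by (induction rule: rtranclp_induct) (auto simp: big_free_collapse_def)

lemma big_free_collapses_Un:
  assumes "(big_free_collapse m)\<^sup>*\<^sup>* K D"
    and Z: "\<And>z A. z \<in> Z \<Longrightarrow> A \<in> K \<Longrightarrow> m \<le> card A \<Longrightarrow> \<not> A \<subseteq> z"
  shows "(big_free_collapse m)\<^sup>*\<^sup>* (K \<union> Z) (D \<union> Z)"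
  using assms(1)
proof (induction rule: rtranclp_induct)
  case base then show ?case by simp
next
  case (step D E)
  have "D \<subseteq> K" using step.hyps(1) by (rule big_free_collapse_subset)
  then have "big_free_collapse m (D \<union> Z) (E \<union> Z)"
    using big_free_collapse_Un[OF step.hyps(2)] Z by blast
  with step.IH show ?case by simp
qed

text \<open>First \<open>K\<close> is collapsed with \<open>L\<close> as a bystander, then
  \<open>L\<close> with the remainder of \<open>K\<close> as a bystander. The hypotheses force all
  common faces to have fewer than \<open>m\<close> vertices.\<close>

lemma collapses_to_card_Un:
  assumes "collapses_to_card m K" "collapses_to_card m L"
    and KL: "\<And>A B. A \<in> K \<Longrightarrow> B \<in> L \<Longrightarrow> m \<le> card A \<Longrightarrow> \<not> A \<subseteq> B"
    and LK: "\<And>A B. A \<in> K \<Longrightarrow> B \<in> L \<Longrightarrow> m \<le> card B \<Longrightarrow> \<not> B \<subseteq> A"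
  shows "collapses_to_card m (K \<union> L)"
proof -
  obtain D where D: "(big_free_collapse m)\<^sup>*\<^sup>* K D" "\<forall>\<sigma>\<in>D. card \<sigma> \<le> m"
    using assms(1) unfolding collapses_to_card_def by blast
  obtain E where E: "(big_free_collapse m)\<^sup>*\<^sup>* L E" "\<forall>\<sigma>\<in>E. card \<sigma> \<le> m"
    using assms(2) unfolding collapses_to_card_def by blast
  have DK: "D \<subseteq> K" using D(1) by (rule big_free_collapse_subset)
  have "(big_free_collapse m)\<^sup>*\<^sup>* (K \<union> L) (D \<union> L)"
    using KL by (intro big_free_collapses_Un[OF D(1)]) blast
  also have "(big_free_collapse m)\<^sup>*\<^sup>* (L \<union> D) (E \<union> D)"
    using LK DK by (intro big_free_collapses_Un[OF E(1)]) blast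
  then have "(big_free_collapse m)\<^sup>*\<^sup>* (D \<union> L) (E \<union> D)" by (simp add: Un_commute)
  finally show ?thesis using D(2) E(2) unfolding collapses_to_card_def by blast
qed

section \<open>Joins with a vertex, links and cones\<close>

lemma big_free_collapse_insert:
  assumes "big_free_collapse m L D" and v: "v \<notin> \<Union>L" and fin: "\<And>A. A \<in> L \<Longrightarrow> finite A"
  shows "big_free_collapse (Suc m) (insert v ` L) (insert v ` D)"
proof -
  obtain \<sigma> \<tau> where f: "free_face L \<sigma> \<tau>" and m: "m \<le> card \<sigma>" and D: "D = L - {\<sigma>, \<tau>}"
    using assms(1) unfolding big_free_collapse_def by blast
  have st: "\<sigma> \<in> L" "\<tau> \<in> L" "\<sigma> \<subset> \<tau>" using f unfolding free_face_def by auto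
  have c: "card (insert v A) = Suc (card A)" if "A \<in> L" for A
    using v fin that by (metis UnionI card_insert_disjoint)
  have inj: "inj_on (insert v) L" using v by (intro inj_onI) (metis UnionI insert_ident)
  have "free_face (insert v ` L) (insert v \<sigma>) (insert v \<tau>)"
    unfolding free_face_def
  proof (intro conjI ballI impI)
    show "insert v \<sigma> \<subset> insert v \<tau>" using st v by (auto 0 3)
    show "face_dim (insert v \<tau>) = face_dim (insert v \<sigma>) + 1"
      using c st free_face_card[OF f] by (simp add: face_dim_def)
    fix \<rho> assume "\<rho> \<in> insert v ` L" and sub: "insert v \<sigma> \<subset> \<rho>"
    then obtain A where A: "A \<in> L" "\<rho> = insert v A" by blast
    then have "\<sigma> \<subset> A" using sub v st(1) by blast
    then show "\<rho> = insert v \<tau>" using f A unfolding free_face_def by blast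
  qed (use st in auto)
  moreover have "insert v ` D = insert v ` L - {insert v \<sigma>, insert v \<tau>}"
    using D inj st by (auto dest: inj_onD)
  ultimately show ?thesis using m c st unfolding big_free_collapse_def
    by (metis Suc_le_mono)
qed

lemma big_free_collapses_insert:
  assumes "(big_free_collapse m)\<^sup>*\<^sup>* L D" and v: "v \<notin> \<Union>L" and fin: "\<And>A. A \<in> L \<Longrightarrow> finite A"
  shows "(big_free_collapse (Suc m))\<^sup>*\<^sup>* (insert v ` L) (insert v ` D)"
  using assms(1)
proof (induction rule: rtranclp_induct)
  case base then show ?case by simp
next
  case (step D E)
  have "D \<subseteq> L" using step.hyps(1) by (rule big_free_collapse_subset)
  then have "big_free_collapse (Suc m) (insert v ` D) (insert v ` E)"
    using v fin by (intro big_free_collapse_insert[OF step.hyps(2)]) blast+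
  with step.IH show ?case by simp
qed

text \<open>The faces through \<open>v\<close> form a copy of the link with all cardinalities raised
  by one, so a collapse of the link lifts to them; faces avoiding \<open>v\<close> cannot contain a
  lifted face and do not interfere. The lifted faces that survive have at most \<open>Suc m\<close>
  vertices, so they contain no face of \<open>N\<close> with at least \<open>Suc m\<close> vertices
  and do not obstruct the collapse of \<open>N\<close>.\<close>

lemma collapses_to_card_link_deletion:
  fixes K :: "'a set set" and v :: 'a
  defines "L \<equiv> {A. v \<notin> A \<and> insert v A \<in> K}" and "N \<equiv> {A \<in> K. v \<notin> A}"
  assumes fin: "\<And>A. A \<in> K \<Longrightarrow> finite A"
    and link: "collapses_to_card m L" and del: "collapses_to_card (Suc m) N"
  shows "collapses_to_card (Suc m) K"
proof -
  have finL: "finite A" if "A \<in> L" for A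
    using fin that unfolding L_def by (metis (mono_tags, lifting) finite_insert mem_Collect_eq)
  have vL: "v \<notin> \<Union>L" unfolding L_def by blast
  have K: "K = insert v ` L \<union> N"
  proof
    show "K \<subseteq> insert v ` L \<union> N"
    proof
      fix A assume A: "A \<in> K"
      show "A \<in> insert v ` L \<union> N"
      proof (cases "v \<in> A")
        case True
        then have "A = insert v (A - {v})" by blast
        moreover from this have "A - {v} \<in> L" using A unfolding L_def by auto
        ultimately show ?thesis by blast
      qed (use A N_def in auto)
    qed
  qed (auto simp: L_def N_def)
  obtain D where D: "(big_free_collapse m)\<^sup>*\<^sup>* L D" "\<forall>\<sigma>\<in>D. card \<sigma> \<le> m"
    using link unfolding collapses_to_card_def by blast
  have DL: "D \<subseteq> L" using D(1) by (rule big_free_collapse_subset)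
  have small: "card (insert v A) \<le> Suc m \<and> finite (insert v A)" if "A \<in> D" for A
    using D(2) that subsetD[OF DL, THEN finL] by (simp add: card_insert_if le_SucI)
  have "(big_free_collapse (Suc m))\<^sup>*\<^sup>* K (insert v ` D \<union> N)"
    unfolding K
    by (rule big_free_collapses_Un[OF big_free_collapses_insert[OF D(1) vL finL]])
      (auto simp: N_def)
  moreover have "collapses_to_card (Suc m) (insert v ` D \<union> N)"
  proof (rule collapses_to_card_Un)
    show "collapses_to_card (Suc m) (insert v ` D)"
      by (rule collapses_to_card_refl) (use small in blast)
    show "collapses_to_card (Suc m) N" by fact
  next
    fix A B assume "A \<in> insert v ` D" "B \<in> N"
    then show "\<not> A \<subseteq> B" by (auto simp: N_def)
  next
    fix A B assume A: "A \<in> insert v ` D" and B: "B \<in> N" "Suc m \<le> card B"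
    show "\<not> B \<subseteq> A"
    proof
      assume "B \<subseteq> A"
      moreover have "card A \<le> Suc m" "finite A" using A small by auto
      ultimately have "B = A" using B(2) by (meson card_seteq le_trans)
      then show False using A B(1) by (auto simp: N_def)
    qed
  qed
  ultimately show ?thesis by (rule collapses_to_card_steps)
qed

text \<open>Each base face \<open>A\<close> is matched with \<open>insert w A\<close>. Removing the
  pairs with \<open>A\<close> maximal first makes every \<open>A\<close> free at its turn. Nothing
  is left, not even the empty face.\<close>

lemma big_free_collapses_cone:
  assumes "finite F" and "w \<notin> \<Union>F" and "\<And>A. A \<in> F \<Longrightarrow> finite A"
  shows "(big_free_collapse 0)\<^sup>*\<^sup>* (F \<union> insert w ` F) {}"
  using assms
proof (induction F rule: finite_psubset_induct)
  case (psubset F)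
  show ?case
  proof (cases "F = {}")
    case True then show ?thesis by simp
  next
    case False
    obtain A where A: "A \<in> F" and max: "\<And>B. B \<in> F \<Longrightarrow> A \<subseteq> B \<Longrightarrow> A = B"
      using finite_has_maximal[OF psubset.hyps(1) False] by metis
    have wA: "w \<notin> A" using A psubset.prems(1) by blast
    have "free_face (F \<union> insert w ` F) A (insert w A)"
      unfolding free_face_def face_dim_def
    proof (intro conjI ballI impI)
      show "int (card (insert w A)) - 1 = int (card A) - 1 + 1"
        using wA psubset.prems(2)[OF A] by simp
      fix \<rho> assume "\<rho> \<in> F \<union> insert w ` F" and sub: "A \<subset> \<rho>"
      then consider "\<rho> \<in> F" | B where "B \<in> F" "\<rho> = insert w B" by blast
      then show "\<rho> = insert w A"
      proof cases
        case 1 then show ?thesis using max sub by blast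
      next
        case 2
        then have "A \<subseteq> B" using sub wA by blast
        then show ?thesis using max 2 by blast
      qed
    qed (use A wA in auto)
    moreover have "(F - {A}) \<union> insert w ` (F - {A}) = (F \<union> insert w ` F) - {A, insert w A}"
    proof -
      have "insert w B \<noteq> insert w A" if "B \<in> F - {A}" for B
        using that psubset.prems(1) wA by (metis DiffD1 DiffD2 UnionI insertI1 insert_ident)
      then show ?thesis using psubset.prems(1) wA by (auto; blast)
    qed
    ultimately have "big_free_collapse 0 (F \<union> insert w ` F) ((F - {A}) \<union> insert w ` (F - {A}))"
      unfolding big_free_collapse_def by auto
    moreover have "(big_free_collapse 0)\<^sup>*\<^sup>* ((F - {A}) \<union> insert w ` (F - {A})) {}"
      using A psubset.prems by (intro psubset.IH) auto
    ultimately show ?thesis by (rule converse_rtranclp_into_rtranclp)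
  qed
qed

lemma Pow_collapses_to_card_0:
  assumes "finite e"
  shows "collapses_to_card 0 (Pow e)"
proof (cases "e = {}")
  case True then show ?thesis by (intro collapses_to_card_refl) simp
next
  case False
  then obtain w where w: "w \<in> e" by blast
  then have "Pow e = Pow (e - {w}) \<union> insert w ` Pow (e - {w})"
    by (metis Pow_insert insert_Diff)
  moreover have "(big_free_collapse 0)\<^sup>*\<^sup>* (Pow (e - {w}) \<union> insert w ` Pow (e - {w})) {}"
    using assms by (intro big_free_collapses_cone) (auto intro: finite_subset)
  ultimately show ?thesis unfolding collapses_to_card_def by auto
qed

subsection \<open>Collapsing hypergraphs of low density\<close>

definition down_closure :: "'a set set \<Rightarrow> 'a set set" where
  "down_closure S = (\<Union>e\<in>S. Pow e)"

text \<open>For finite families of finite edges and \<open>m = 1\<close> this says that the edges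
  with at least two vertices form a hyperforest, that is, have an acyclic incidence graph. The
  natural subtraction is exact because smaller edges are excluded from \<open>T\<close>.\<close>

definition dense_free :: "nat \<Rightarrow> 'a set set \<Rightarrow> bool" where
  "dense_free m S \<longleftrightarrow>
     (\<forall>T\<subseteq>S. T \<noteq> {} \<longrightarrow> (\<forall>e\<in>T. m < card e) \<longrightarrow> (\<Sum>e\<in>T. card e - m) < card (\<Union>T))"

lemma dense_freeD:
  "dense_free m S \<Longrightarrow> T \<subseteq> S \<Longrightarrow> T \<noteq> {} \<Longrightarrow> (\<And>e. e \<in> T \<Longrightarrow> m < card e) \<Longrightarrow>
    (\<Sum>e\<in>T. card e - m) < card (\<Union>T)"
  unfolding dense_free_def by blast

lemma Union_image_Diff_singleton: "\<Union>((\<lambda>e. e - {v}) ` T) = \<Union>T - {v}"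
  by blast

text \<open>If \<open>v\<close> is covered, the union loses one vertex, but some edge through
  \<open>v\<close> also loses one, so both sides drop. If \<open>v\<close> is not covered, the union
  does not change.\<close>

lemma dense_free_deletion:
  assumes d: "dense_free m S" and "finite S" and fin: "\<And>e. e \<in> S \<Longrightarrow> finite e"
  shows "dense_free m ((\<lambda>e. e - {v}) ` S)"
  unfolding dense_free_def
proof (intro allI impI)
  fix T' assume "T' \<subseteq> (\<lambda>e. e - {v}) ` S" and ne: "T' \<noteq> {}" and big: "\<forall>e\<in>T'. m < card e"
  \<comment> \<open>Different edges may coincide once \<open>v\<close> is removed; \<open>T\<close>
    contains one preimage of each.\<close>
  then obtain T where T: "T \<subseteq> S" "inj_on (\<lambda>e. e - {v}) T" "T' = (\<lambda>e. e - {v}) ` T"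
    by (auto simp: subset_image_inj)
  have finT: "finite T" "\<And>e. e \<in> T \<Longrightarrow> finite e" using T(1) assms(2) fin finite_subset by blast+
  have bigT: "m < card e" if "e \<in> T" for e
    using big T(3) that card_Diff1_le[of e v] by fastforce
  have lt: "(\<Sum>e\<in>T. card e - m) < card (\<Union>T)"
    using T(1) ne T(3) bigT by (intro dense_freeD[OF d]) auto
  have sum': "(\<Sum>e\<in>T'. card e - m) = (\<Sum>e\<in>T. card (e - {v}) - m)"
    unfolding T(3) by (subst sum.reindex[OF T(2)]) simp
  have le: "(\<Sum>e\<in>T. card (e - {v}) - m) \<le> (\<Sum>e\<in>T. card e - m)"
    by (intro sum_mono diff_le_mono card_Diff1_le)
  show "(\<Sum>e\<in>T'. card e - m) < card (\<Union>T')"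
  proof (cases "v \<in> \<Union>T")
    case False
    then have "\<Union>T' = \<Union>T" unfolding T(3) by blast
    then show ?thesis using lt sum' le by simp
  next
    case True
    then obtain e0 where e0: "e0 \<in> T" "v \<in> e0" by blast
    have "(\<Sum>e\<in>T. card (e - {v}) - m) < (\<Sum>e\<in>T. card e - m)"
    proof (rule sum_strict_mono_ex1[OF finT(1)])
      show "\<forall>e\<in>T. card (e - {v}) - m \<le> card e - m" by (simp add: card_Diff1_le diff_le_mono)
      have "card (e0 - {v}) < card e0" using e0 finT(2) by (intro card_Diff1_less) auto
      then show "\<exists>e\<in>T. card (e - {v}) - m < card e - m"
        using e0(1) bigT[of e0] by (intro bexI[of _ e0]) auto
    qed
    moreover have "card (\<Union>T') = card (\<Union>T) - 1"
      unfolding T(3) Union_image_Diff_singleton using True by simp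
    ultimately show ?thesis using lt sum' by simp
  qed
qed

text \<open>In the link, edge sizes and the threshold both drop by one, so the sum is unchanged
  while the union loses \<open>v\<close>. The strict inequality survives exactly when there was room
  to spare, which is what \<open>slack\<close> provides.\<close>

lemma dense_free_link:
  assumes d: "dense_free (Suc m) S" and "finite S" and fin: "\<And>e. e \<in> S \<Longrightarrow> finite e"
    and slack: "\<And>T. T \<subseteq> S \<Longrightarrow> T \<noteq> {} \<Longrightarrow> (\<And>e. e \<in> T \<Longrightarrow> Suc m < card e \<and> v \<in> e) \<Longrightarrow>
      (\<Sum>e\<in>T. card e - Suc m) + 1 \<noteq> card (\<Union>T)"
  shows "dense_free m ((\<lambda>e. e - {v}) ` {e \<in> S. v \<in> e})"
  unfolding dense_free_def
proof (intro allI impI)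
  fix T' assume "T' \<subseteq> (\<lambda>e. e - {v}) ` {e \<in> S. v \<in> e}" and ne: "T' \<noteq> {}" and big: "\<forall>e\<in>T'. m < card e"
  then obtain T where T: "T \<subseteq> {e \<in> S. v \<in> e}" "inj_on (\<lambda>e. e - {v}) T" "T' = (\<lambda>e. e - {v}) ` T"
    by (auto simp: subset_image_inj)
  have c: "card (e - {v}) = card e - 1" if "e \<in> T" for e using T(1) that by auto
  have bigT: "Suc m < card e" if "e \<in> T" for e
    using big T(3) that c by fastforce
  have "(\<Sum>e\<in>T. card e - Suc m) < card (\<Union>T)"
    using T(1) ne T(3) bigT by (intro dense_freeD[OF d]) auto
  moreover have "(\<Sum>e\<in>T. card e - Suc m) + 1 \<noteq> card (\<Union>T)"
    using T(1) ne T(3) bigT by (intro slack) auto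
  moreover have "(\<Sum>e\<in>T'. card e - m) = (\<Sum>e\<in>T. card e - Suc m)"
    unfolding T(3) by (subst sum.reindex[OF T(2)]) (auto intro!: sum.cong simp: c)
  moreover have "card (\<Union>T') = card (\<Union>T) - 1"
    unfolding T(3) Union_image_Diff_singleton using ne T(1,3) by (subst card_Diff_singleton) auto
  ultimately show "(\<Sum>e\<in>T'. card e - m) < card (\<Union>T')" by linarith
qed

text \<open>A hyperforest has a leaf. If every vertex had degree at least 2, double counting of
  incidences would bound both \<open>2 * card (\<Union>B)\<close> and \<open>2 * card B\<close> by
  the sum of the edge sizes, whereas density makes that sum less than
  \<open>card (\<Union>B) + card B\<close>.\<close>

lemma dense_free_leaf:
  assumes d: "dense_free 1 S" and "finite S" and fin: "\<And>e. e \<in> S \<Longrightarrow> finite e"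
    and ne: "\<Union>S \<noteq> {}"
  shows "\<exists>v\<in>\<Union>S. card {e \<in> S. 1 < card e \<and> v \<in> e} \<le> 1"
proof (rule ccontr)
  assume contra: "\<not> ?thesis"
  define B where "B = {e \<in> S. 1 < card e}"
  have B: "finite B" "finite (\<Union>B)" "\<And>e. e \<in> B \<Longrightarrow> finite e" using assms unfolding B_def by auto
  have deg: "2 \<le> card {e \<in> B. v \<in> e}" if "v \<in> \<Union>S" for v
    using contra that by (fastforce simp: B_def conj_ac)
  have "B \<noteq> {}" using ne deg by fastforce
  then have lt: "(\<Sum>e\<in>B. card e - 1) < card (\<Union>B)"
    by (intro dense_freeD[OF d]) (auto simp: B_def)
  have "(\<Sum>e\<in>B. card e - 1) + card B = (\<Sum>e\<in>B. (card e - 1) + 1)"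
    by (simp add: sum_Suc)
  also have "\<dots> = (\<Sum>e\<in>B. card e)" by (intro sum.cong) (auto simp: B_def)
  finally have e1: "(\<Sum>e\<in>B. card e - 1) + card B = (\<Sum>e\<in>B. card e)" .
  have "2 * card B = (\<Sum>e\<in>B. 2)" by simp
  also have "\<dots> \<le> (\<Sum>e\<in>B. card e)" by (intro sum_mono) (auto simp: B_def)
  finally have e2: "2 * card B \<le> (\<Sum>e\<in>B. card e)" .
  have "2 * card (\<Union>B) = (\<Sum>v\<in>\<Union>B. 2)" by simp
  also have "\<dots> \<le> (\<Sum>v\<in>\<Union>B. card {e \<in> B. v \<in> e})"
    by (intro sum_mono deg) (auto simp: B_def)
  also have "\<dots> = (\<Sum>v\<in>\<Union>B. \<Sum>e\<in>{e \<in> B. v \<in> e}. 1)" by simp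
  also have "\<dots> = (\<Sum>e\<in>B. \<Sum>v\<in>{v \<in> \<Union>B. v \<in> e}. 1)"
    using B by (intro sum.swap_restrict)
  also have "\<dots> = (\<Sum>e\<in>B. card e)"
    by (simp, intro sum.cong refl arg_cong[of _ _ card]) auto
  finally show False using lt e1 e2 by linarith
qed

text \<open>The extremal case of \<open>dense_free\<close>. A tight family whose edges all contain
  \<open>v\<close> is the obstruction to passing to the link of \<open>v\<close>.\<close>

definition tight_family :: "nat \<Rightarrow> 'a set set \<Rightarrow> bool" where
  "tight_family m T \<longleftrightarrow> T \<noteq> {} \<and> (\<forall>e\<in>T. m < card e) \<and> (\<Sum>e\<in>T. card e - m) + 1 = card (\<Union>T)"

text \<open>Submodularity of \<open>card (\<Union>T) - (\<Sum>e\<in>T. card e - m)\<close>, which is at least 1 on nonempty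
  families.\<close>

lemma tight_family_Int:
  assumes d: "dense_free m S" and "finite S" and fin: "\<And>e. e \<in> S \<Longrightarrow> finite e"
    and A: "A \<subseteq> S" "tight_family m A" and B: "B \<subseteq> S" "tight_family m B" and ne: "A \<inter> B \<noteq> {}"
  shows "tight_family m (A \<inter> B)"
proof -
  let ?w = "\<lambda>T. \<Sum>e\<in>T. card e - m"
  have fAB: "finite A" "finite B" using A B assms(2) finite_subset by blast+
  have fU: "finite (\<Union>A)" "finite (\<Union>B)" using fAB A B fin by auto
  have "?w (A \<union> B) < card (\<Union>(A \<union> B))"
    using A B ne by (intro dense_freeD[OF d]) (auto simp: tight_family_def)
  moreover have lt: "?w (A \<inter> B) < card (\<Union>(A \<inter> B))"
    using A B ne by (intro dense_freeD[OF d]) (auto simp: tight_family_def)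
  moreover have "?w (A \<union> B) + ?w (A \<inter> B) = ?w A + ?w B"
    by (rule sum.union_inter[OF fAB])
  moreover have "card (\<Union>A) + card (\<Union>B) = card (\<Union>(A \<union> B)) + card (\<Union>A \<inter> \<Union>B)"
    using card_Un_Int[OF fU] by (simp add: Union_Un_distrib)
  moreover have "card (\<Union>(A \<inter> B)) \<le> card (\<Union>A \<inter> \<Union>B)"
    using fU by (intro card_mono) auto
  ultimately have "?w (A \<inter> B) + 1 = card (\<Union>(A \<inter> B))"
    using A(2) B(2) unfolding tight_family_def by linarith
  then show ?thesis using A(2) ne unfolding tight_family_def by auto
qed

text \<open>The minimal tight families are pairwise disjoint. If every vertex \<open>v\<close> were common to all
  members of some minimal tight family, then, since each minimal tight family also covers a vertex
  that is not common to its members, their union would be too dense.\<close>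

lemma exists_vertex_without_tight_family:
  assumes d: "dense_free m S" and finS: "finite S" and fin: "\<And>e. e \<in> S \<Longrightarrow> finite e"
    and ne: "\<Union>S \<noteq> {}" and m: "2 \<le> m"
  shows "\<exists>v\<in>\<Union>S. \<forall>T\<subseteq>S. tight_family m T \<longrightarrow> \<not> v \<in> \<Inter>T"
proof (rule ccontr)
  assume "\<not> ?thesis"
  then have ex: "\<exists>T\<subseteq>S. tight_family m T \<and> v \<in> \<Inter>T" if "v \<in> \<Union>S" for v using that by blast
  define M where "M = {T. T \<subseteq> S \<and> tight_family m T \<and> (\<forall>T'\<subseteq>T. tight_family m T' \<longrightarrow> T' = T)}"
  have MS: "M \<subseteq> Pow S" unfolding M_def by blast
  then have finM: "finite M" using finS finite_subset by blast
  have finMT: "finite T" "finite (\<Union>T)" if "T \<in> M" for T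
    using that MS finS fin by (meson PowD finite_Union finite_subset subsetD)+
  have exM: "\<exists>T\<in>M. v \<in> \<Inter>T" if v: "v \<in> \<Union>S" for v
  proof -
    obtain T where T: "T \<subseteq> S" "tight_family m T" "v \<in> \<Inter>T" using ex[OF v] by blast
    have "finite {T'. T' \<subseteq> T \<and> tight_family m T'}"
      using finite_subset[OF T(1) finS] by simp
    then obtain U where U: "U \<subseteq> T" "tight_family m U" "\<And>U'. U' \<subseteq> T \<Longrightarrow> tight_family m U' \<Longrightarrow> U' \<subseteq> U \<Longrightarrow> U = U'"
      using finite_has_minimal2[of "{T'. T' \<subseteq> T \<and> tight_family m T'}" T] T(2) by auto
    have "\<forall>U'\<subseteq>U. tight_family m U' \<longrightarrow> U' = U" using U by blast
    then have "U \<in> M" using U(1,2) T(1) unfolding M_def by auto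
    then show ?thesis using T(3) U(1) by blast
  qed
  have disj: "A \<inter> B = {}" if "A \<in> M" "B \<in> M" "A \<noteq> B" for A B
  proof (rule ccontr)
    assume "A \<inter> B \<noteq> {}"
    then have "tight_family m (A \<inter> B)"
      using that unfolding M_def by (intro tight_family_Int[OF d finS fin]) auto
    then have "A \<inter> B = A" "A \<inter> B = B" using that unfolding M_def by auto
    then show False using that by blast
  qed
  \<comment> \<open>Otherwise \<open>T\<close> is a single edge \<open>e\<close>, and tightness
    \<open>card e - m + 1 = card e\<close> forces \<open>m = 1\<close>. This is where
    \<open>2 \<le> m\<close> enters.\<close>
  have noncommon: "1 \<le> card (\<Union>T - \<Inter>T)" if T: "T \<in> M" for T
  proof (rule ccontr)
    assume "\<not> ?thesis"
    then have "\<Union>T \<subseteq> \<Inter>T" using finMT[OF T] by (simp add: Suc_le_eq card_gt_0_iff)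
    moreover obtain e where e: "e \<in> T" using T unfolding M_def tight_family_def by blast
    ultimately have "T = {e}" by blast
    then have "card e - m + 1 = card e" "m < card e" using T unfolding M_def tight_family_def by auto
    then show False using m by simp
  qed
  \<comment> \<open>By disjointness, the weight of \<open>R\<close> is the sum of
    \<open>card (\<Union>T) - 1\<close> over \<open>M\<close>, hence at least the sum of
    \<open>card (\<Inter>T)\<close>. The sets \<open>\<Inter>T\<close> cover all vertices, so this
    is at least \<open>card (\<Union>R)\<close>, against density.\<close>
  define R where "R = \<Union>M"
  have RS: "R \<subseteq> S" using MS unfolding R_def by blast
  have "M \<noteq> {}" using ne exM by fastforce
  then have "R \<noteq> {}" unfolding R_def M_def tight_family_def by blast
  then have "(\<Sum>e\<in>R. card e - m) < card (\<Union>R)"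
    using RS by (intro dense_freeD[OF d]) (auto simp: R_def M_def tight_family_def)
  moreover have "(\<Sum>e\<in>R. card e - m) = (\<Sum>T\<in>M. \<Sum>e\<in>T. card e - m)"
    unfolding R_def using finMT disj by (subst sum.Union_disjoint) (auto simp: o_def)
  moreover have "(\<Sum>T\<in>M. \<Sum>e\<in>T. card e - m) + card M = (\<Sum>T\<in>M. (\<Sum>e\<in>T. card e - m) + 1)"
    by (simp add: sum_Suc)
  moreover have "\<dots> = (\<Sum>T\<in>M. card (\<Union>T))"
    by (intro sum.cong) (auto simp: M_def tight_family_def)
  moreover have "(\<Sum>T\<in>M. card (\<Union>T)) \<ge> (\<Sum>T\<in>M. card (\<Inter>T) + 1)"
  proof (rule sum_mono)
    fix T assume T: "T \<in> M"
    then have "T \<noteq> {}" unfolding M_def tight_family_def by blast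
    then have "\<Inter>T \<subseteq> \<Union>T" by blast
    then have "card (\<Union>T - \<Inter>T) = card (\<Union>T) - card (\<Inter>T)" "card (\<Inter>T) \<le> card (\<Union>T)"
      using finMT[OF T] by (auto intro: card_Diff_subset card_mono finite_subset)
    then show "card (\<Inter>T) + 1 \<le> card (\<Union>T)" using noncommon[OF T] by linarith
  qed
  moreover have "(\<Sum>T\<in>M. card (\<Inter>T) + 1) = (\<Sum>T\<in>M. card (\<Inter>T)) + card M"
    by (simp add: sum_Suc)
  moreover have "card (\<Union>R) \<le> (\<Sum>T\<in>M. card (\<Inter>T))"
  proof -
    have "\<Union>R \<subseteq> (\<Union>T\<in>M. \<Inter>T)" using RS exM by blast
    moreover have "finite (\<Inter>T)" if T: "T \<in> M" for T
    proof -
      have "T \<noteq> {}" using T unfolding M_def tight_family_def by blast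
      then have "\<Inter>T \<subseteq> \<Union>T" by blast
      then show ?thesis using finMT[OF T] finite_subset by blast
    qed
    ultimately have "card (\<Union>R) \<le> card (\<Union>T\<in>M. \<Inter>T)" using finM by (intro card_mono) auto
    also have "\<dots> \<le> (\<Sum>T\<in>M. card (\<Inter>T))" by (rule card_UN_le[OF finM])
    finally show ?thesis .
  qed
  ultimately show False by linarith
qed

text \<open>Induction on the number of covered vertices, for all \<open>m\<close> at once because
  the link is treated with \<open>m - 1\<close>. All the freedom lies in the choice of
  \<open>v\<close>.\<close>

lemma dense_free_collapses:
  assumes "dense_free m S" and "finite S" and "\<And>e. e \<in> S \<Longrightarrow> finite e" and "1 \<le> m"
  shows "collapses_to_card m (down_closure S)"
  using assms
proof (induction "card (\<Union>S)" arbitrary: m S rule: less_induct)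
  case less
  note fin = less.prems(3)
  have finU: "finite (\<Union>S)" using less.prems by blast
  obtain k where k: "m = Suc k" using less.prems(4) by (cases m) auto
  show ?case
  proof (cases "\<Union>S = {}")
    case True
    then show ?thesis by (intro collapses_to_card_refl) (auto simp: down_closure_def)
  next
    case ne: False
    let ?link = "\<lambda>v. {A. v \<notin> A \<and> insert v A \<in> down_closure S}"
    have smaller: "card (\<Union>((\<lambda>e. e - {v}) ` T)) < card (\<Union>S)" if "v \<in> \<Union>S" "T \<subseteq> S" for v T
      using that finU by (intro psubset_card_mono) auto
    have "\<exists>v\<in>\<Union>S. collapses_to_card k (?link v)"
    \<comment> \<open>For \<open>m = 1\<close> the link must collapse to threshold 0, which the
      induction does not reach. Here \<open>v\<close> is a leaf, and its link is a full simplex or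
      just the empty face.\<close>
    proof (cases "k = 0")
      case True
      then obtain v where v: "v \<in> \<Union>S" "card {e \<in> S. 1 < card e \<and> v \<in> e} \<le> 1"
        using dense_free_leaf[of S] less.prems ne k by auto
      have small: "A = {}" if "A \<in> ?link v" "e \<in> S" "insert v A \<subseteq> e" "card e \<le> 1" for A e
      proof -
        have "finite A" using fin[OF that(2)] that(3) by (auto intro: finite_subset)
        moreover have "card (insert v A) \<le> 1"
          using that(3,4) card_mono[OF fin[OF that(2)]] by (meson le_trans)
        ultimately show ?thesis using that(1) by (simp add: card_insert_if)
      qed
      have "collapses_to_card 0 (?link v)"
      proof (cases "\<exists>e\<in>S. 1 < card e \<and> v \<in> e")
        case False
        have "card A \<le> 0" if A: "A \<in> ?link v" for A
        proof -
          obtain e where e: "e \<in> S" "insert v A \<subseteq> e" using A unfolding down_closure_def by blast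
          then have "card e \<le> 1" using False by (meson insert_subset not_le)
          then have "A = {}" using small A e by blast
          then show ?thesis by simp
        qed
        then show ?thesis by (rule collapses_to_card_refl)
      next
        case True
        then obtain e where e: "e \<in> S" "1 < card e" "v \<in> e" by blast
        have uniq: "e' = e" if "e' \<in> S" "1 < card e'" "v \<in> e'" for e'
          using that e v(2) \<open>finite S\<close> card_le_Suc0_iff_eq[of "{e \<in> S. 1 < card e \<and> v \<in> e}"]
          by auto
        have "?link v = Pow (e - {v})"
        proof (intro equalityI subsetI)
          fix A assume A: "A \<in> ?link v"
          then obtain e' where e': "e' \<in> S" "insert v A \<subseteq> e'" unfolding down_closure_def by blast
          show "A \<in> Pow (e - {v})"
          proof (cases "1 < card e'")
            case True
            then show ?thesis using uniq e' A by auto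
          next
            case False
            then have "A = {}" using small A e' by (meson not_le)
            then show ?thesis by simp
          qed
        qed (use e in \<open>auto simp: down_closure_def\<close>)
        then show ?thesis using Pow_collapses_to_card_0[of "e - {v}"] fin e(1) by simp
      qed
      then show ?thesis using v \<open>k = 0\<close> by blast
    next
      case False
      then have "2 \<le> m" using k by simp
      then obtain v where v: "v \<in> \<Union>S" "\<forall>T\<subseteq>S. tight_family m T \<longrightarrow> \<not> v \<in> \<Inter>T"
        using exists_vertex_without_tight_family[OF less.prems(1-3) ne] by blast
      let ?S = "(\<lambda>e. e - {v}) ` {e \<in> S. v \<in> e}"
      have "dense_free k ?S"
      proof (rule dense_free_link)
        show "dense_free (Suc k) S" using less.prems(1) k by simp
        fix T assume "T \<subseteq> S" "T \<noteq> {}" "\<And>e. e \<in> T \<Longrightarrow> Suc k < card e \<and> v \<in> e"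
        then show "(\<Sum>e\<in>T. card e - Suc k) + 1 \<noteq> card (\<Union>T)"
          using v(2) k unfolding tight_family_def by blast
      qed (use less.prems in auto)
      then have "collapses_to_card k (down_closure ?S)"
        using False less.prems(2,3) smaller[OF v(1), of "{e \<in> S. v \<in> e}"]
        by (intro less.hyps) auto
      moreover have "down_closure ?S = ?link v" unfolding down_closure_def by auto
      ultimately show ?thesis using v(1) by auto
    qed
    then obtain v where v: "v \<in> \<Union>S" "collapses_to_card k (?link v)" by blast
    let ?S = "(\<lambda>e. e - {v}) ` S"
    have "collapses_to_card m (down_closure ?S)"
      using less.prems smaller[OF v(1), of S]
      by (intro less.hyps dense_free_deletion) auto
    moreover have "down_closure ?S = {A \<in> down_closure S. v \<notin> A}"
      unfolding down_closure_def by auto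
    ultimately have "collapses_to_card (Suc k) {A \<in> down_closure S. v \<notin> A}" using k by simp
    moreover have "finite A" if "A \<in> down_closure S" for A
      using that fin finite_subset unfolding down_closure_def by blast
    ultimately show ?thesis
      unfolding k using v(2) collapses_to_card_link_deletion[of "down_closure S" k v] by blast
  qed
qed

subsection \<open>Collapsing locally sparse hypergraphs\<close>

text \<open>Only families of at most \<open>N\<close> edges are tested, so that a first moment bound
  needs finitely many shapes. The term \<open>- 1\<close> leaves a margin: a violating family
  satisfies \<open>card (\<Union>T) + \<epsilon> \<le> (\<Sum>e\<in>T. real (card e) - real m +
  \<epsilon>)\<close>.\<close>

definition locally_sparse :: "real \<Rightarrow> nat \<Rightarrow> nat \<Rightarrow> 'a set set \<Rightarrow> bool" where
  "locally_sparse \<epsilon> N m S \<longleftrightarrow>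
     (\<forall>T\<subseteq>S. T \<noteq> {} \<longrightarrow> card T \<le> N \<longrightarrow> (\<forall>e\<in>T. m < card e) \<longrightarrow>
       \<epsilon> * (real (card T) - 1) < real (card (\<Union>T)) - (\<Sum>e\<in>T. real (card e) - real m))"

lemma locally_sparse_subset: "locally_sparse \<epsilon> N m S \<Longrightarrow> T \<subseteq> S \<Longrightarrow> locally_sparse \<epsilon> N m T"
  unfolding locally_sparse_def by (meson subset_trans)

lemma locally_sparse_imp_dense_free:
  assumes s: "locally_sparse \<epsilon> N m S" and "finite S" "card S \<le> N" "0 \<le> \<epsilon>"
  shows "dense_free m S"
  unfolding dense_free_def
proof (intro allI impI)
  fix T assume T: "T \<subseteq> S" "T \<noteq> {}" "\<forall>e\<in>T. m < card e"
  have fT: "finite T" using T(1) assms(2) finite_subset by blast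
  have cT: "card T \<le> N" using T(1) assms(2,3) card_mono le_trans by blast
  have "1 \<le> card T" using T(2) fT by (simp add: Suc_le_eq card_gt_0_iff)
  then have "0 \<le> \<epsilon> * (real (card T) - 1)" using assms(4) by simp
  also have "\<dots> < real (card (\<Union>T)) - (\<Sum>e\<in>T. real (card e) - real m)"
    using s T cT unfolding locally_sparse_def by blast
  also have "(\<Sum>e\<in>T. real (card e) - real m) = real (\<Sum>e\<in>T. card e - m)"
    using T(3) by (simp add: of_nat_diff less_imp_le)
  finally show "(\<Sum>e\<in>T. card e - m) < card (\<Union>T)"
    by (simp only: of_nat_less_iff diff_gt_0_iff_gt)
qed

text \<open>Adding an edge which meets the vertices covered so far in at least \<open>m\<close> points does not
  increase \<open>card (\<Union>T) - (\<Sum>e\<in>T. card e - m)\<close>, so an unsplittable family contains subfamilies of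
  every size for which this quantity is at most \<open>m\<close>.\<close>

lemma unsplittable_chain:
  assumes finS: "finite S" and fin: "\<And>e. e \<in> S \<Longrightarrow> finite e" and big: "\<And>e. e \<in> S \<Longrightarrow> m < card e"
    and conn: "\<And>T. T \<subset> S \<Longrightarrow> T \<noteq> {} \<Longrightarrow> \<exists>e\<in>T. \<exists>f\<in>S - T. m \<le> card (e \<inter> f)"
    and k: "1 \<le> k" "k \<le> card S"
  shows "\<exists>T\<subseteq>S. card T = k \<and> real (card (\<Union>T)) - (\<Sum>e\<in>T. real (card e) - real m) \<le> real m"
  using k
proof (induction k rule: dec_induct)
  case base
  then obtain e where "e \<in> S" by fastforce
  then show ?case by (intro exI[of _ "{e}"]) auto
next
  case (step k)
  then obtain T where T: "T \<subseteq> S" "card T = k"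
    "real (card (\<Union>T)) - (\<Sum>e\<in>T. real (card e) - real m) \<le> real m" by auto
  have "T \<noteq> {}" "T \<subset> S" using T step by auto
  then obtain e f where ef: "e \<in> T" "f \<in> S - T" "m \<le> card (e \<inter> f)" using conn by meson
  have fT: "finite T" using T(1) finS finite_subset by blast
  have fU: "finite (\<Union>T)" using fT fin T(1) by blast
  have "card (e \<inter> f) \<le> card (\<Union>T \<inter> f)" using fU ef(1) by (intro card_mono) auto
  moreover have "card (\<Union>T) + card f = card (\<Union>T \<union> f) + card (\<Union>T \<inter> f)"
    using ef fin by (intro card_Un_Int fU) auto
  ultimately have "real (card (f \<union> \<Union>T)) \<le> real (card (\<Union>T)) + (real (card f) - real m)"
    using ef(3) by (simp add: Un_commute)
  then have "real (card (\<Union>(insert f T))) - (\<Sum>e\<in>insert f T. real (card e) - real m) \<le> real m"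
    using T(3) fT ef(2) by simp
  moreover have "card (insert f T) = Suc k" using T(2) fT ef(2) by simp
  ultimately show ?case using T(1) ef(2) by (intro exI[of _ "insert f T"]) auto
qed

text \<open>Parts that share no face with \<open>m\<close> vertices are collapsed separately. An
  unsplittable family has at most \<open>N\<close> edges: otherwise
  \<open>unsplittable_chain\<close> gives \<open>N\<close> edges with excess at most
  \<open>m\<close>, while sparsity makes the excess larger than
  \<open>\<epsilon> * (real N - 1)\<close>. So sparsity applies to all its subfamilies.\<close>

lemma locally_sparse_collapses_big:
  assumes "finite S" and "\<And>e. e \<in> S \<Longrightarrow> finite e" and "\<And>e. e \<in> S \<Longrightarrow> m < card e"
    and "locally_sparse \<epsilon> N m S" and "0 < \<epsilon>" and "real m \<le> \<epsilon> * (real N - 1)" and "1 \<le> N" and "1 \<le> m"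
  shows "collapses_to_card m (down_closure S)"
  using assms
proof (induction S rule: finite_psubset_induct)
  case (psubset S)
  note fin = psubset.prems(1) and big = psubset.prems(2) and sparse = psubset.prems(3)
  show ?case
  proof (cases "\<exists>T. T \<subset> S \<and> T \<noteq> {} \<and> (\<forall>e\<in>T. \<forall>f\<in>S - T. card (e \<inter> f) < m)")
    case True
    then obtain T where T: "T \<subset> S" "T \<noteq> {}" "\<And>e f. e \<in> T \<Longrightarrow> f \<in> S - T \<Longrightarrow> card (e \<inter> f) < m"
      by blast
    have "collapses_to_card m (down_closure T)" "collapses_to_card m (down_closure (S - T))"
      using T psubset.prems
      by (auto intro!: psubset.IH intro: locally_sparse_subset[OF sparse])
    moreover have no: False
      if AB: "A \<in> down_closure T" "B \<in> down_closure (S - T)"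
        and C: "C \<subseteq> A" "C \<subseteq> B" "m \<le> card C" for A B C
    proof -
      obtain e f where ef: "e \<in> T" "f \<in> S - T" "C \<subseteq> e \<inter> f"
        using AB C(1,2) unfolding down_closure_def by blast
      then have "card C \<le> card (e \<inter> f)" using fin T(1) by (intro card_mono) auto
      then show False using T(3)[OF ef(1,2)] C(3) by simp
    qed
    ultimately have "collapses_to_card m (down_closure T \<union> down_closure (S - T))"
      by (intro collapses_to_card_Un) blast+
    moreover have "down_closure T \<union> down_closure (S - T) = down_closure S"
      using T(1) unfolding down_closure_def by blast
    ultimately show ?thesis by simp
  next
    case False
    then have conn: "\<exists>e\<in>T. \<exists>f\<in>S - T. m \<le> card (e \<inter> f)" if "T \<subset> S" "T \<noteq> {}" for T
      using that by (meson not_le)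
    have "card S \<le> N"
    proof (rule ccontr)
      assume "\<not> ?thesis"
      then obtain T where T: "T \<subseteq> S" "card T = N"
        "real (card (\<Union>T)) - (\<Sum>e\<in>T. real (card e) - real m) \<le> real m"
        using unsplittable_chain[OF psubset.hyps fin big conn psubset.prems(6)] by force
      then have "T \<noteq> {}" using psubset.prems(6) by auto
      then have "\<epsilon> * (real N - 1) < real (card (\<Union>T)) - (\<Sum>e\<in>T. real (card e) - real m)"
        using sparse T(1,2) big unfolding locally_sparse_def by (auto simp: subset_iff)
      then have "\<epsilon> * (real N - 1) < real m" using T(3) by linarith
      then show False using psubset.prems(5) by simp
    qed
    then have "dense_free m S"
      using sparse psubset.hyps psubset.prems(4) by (intro locally_sparse_imp_dense_free) auto
    then show ?thesis using psubset by (intro dense_free_collapses) auto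
  qed
qed

text \<open>Edges with at most \<open>m\<close> vertices contribute only faces that need not be
  removed, and none of the new ones contains a face of \<open>down_closure ?B\<close> with
  \<open>m\<close> vertices.\<close>

lemma locally_sparse_collapses:
  assumes finS: "finite S" and fin: "\<And>e. e \<in> S \<Longrightarrow> finite e"
    and "locally_sparse \<epsilon> N m S" and "0 < \<epsilon>" and "real m \<le> \<epsilon> * (real N - 1)" and "1 \<le> N" and "1 \<le> m"
  shows "collapses_to_card m (down_closure S)"
proof -
  let ?B = "{e \<in> S. m < card e}"
  let ?Z = "down_closure S - down_closure ?B"
  have small: "finite A \<and> card A \<le> m" if "A \<in> ?Z" for A
  proof -
    obtain e where e: "e \<in> S" "A \<subseteq> e" using \<open>A \<in> ?Z\<close> unfolding down_closure_def by blast
    then have "\<not> m < card e" using \<open>A \<in> ?Z\<close> unfolding down_closure_def by blast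
    then show ?thesis using e fin by (meson card_mono finite_subset le_trans not_le)
  qed
  have down: "A \<in> down_closure ?B" if "A \<subseteq> A'" "A' \<in> down_closure ?B" for A A'
    using that unfolding down_closure_def by blast
  have "collapses_to_card m (down_closure ?B)"
    using assms by (intro locally_sparse_collapses_big) (auto intro: locally_sparse_subset)
  then have "collapses_to_card m (down_closure ?B \<union> ?Z)"
  proof (rule collapses_to_card_Un)
    show "collapses_to_card m ?Z" using small by (intro collapses_to_card_refl) blast
  next
    fix A B assume A: "A \<in> down_closure ?B" and B: "B \<in> ?Z" and m: "m \<le> card A"
    show "\<not> A \<subseteq> B"
    proof
      assume "A \<subseteq> B"
      then have "A = B" using small[OF B] m by (meson card_seteq le_trans)
      then show False using A B by blast
    qed
  next
    fix A B assume "A \<in> down_closure ?B" "B \<in> ?Z"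
    then show "\<not> B \<subseteq> A" using down by blast
  qed
  moreover have "down_closure ?B \<union> ?Z = down_closure S" unfolding down_closure_def by blast
  ultimately show ?thesis by simp
qed

section \<open>Back to simplicial complexes without the empty face\<close>

lemma simplicial_complex_down_closure:
  assumes "\<And>e. e \<in> H \<Longrightarrow> finite e \<and> e \<noteq> {}"
  shows "simplicial_complex (down_closure H - {{}})"
proof -
  have "B \<in> down_closure H" if "A \<in> down_closure H" "B \<subseteq> A" for A B
    using that unfolding down_closure_def by blast
  moreover have "finite A" if "A \<in> down_closure H" for A
    using that assms finite_subset unfolding down_closure_def by blast
  ultimately show ?thesis unfolding simplicial_complex_def by blast
qed

lemma hull_simplicial_complex:
  assumes "\<And>e. e \<in> H \<Longrightarrow> finite e \<and> e \<noteq> {}"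
  shows "simplicial_complex hull H = down_closure H - {{}}"
proof (rule hull_unique)
  show "H \<subseteq> down_closure H - {{}}" using assms unfolding down_closure_def by blast
  show "simplicial_complex (down_closure H - {{}})"
    using assms by (rule simplicial_complex_down_closure)
  fix K assume "H \<subseteq> K" "simplicial_complex K"
  then show "down_closure H - {{}} \<subseteq> K"
    unfolding down_closure_def simplicial_complex_def by blast
qed

text \<open>In \<open>C\<close> only \<sigma> and \<tau> contain \<sigma>, so no remaining face has
  either of them as a subset.\<close>

lemma simplicial_complex_elementary_collapse:
  assumes "elementary_collapse C D" "simplicial_complex C"
  shows "simplicial_complex D"
proof -
  obtain \<sigma> \<tau> where f: "\<And>\<rho>. \<rho> \<in> C \<Longrightarrow> \<sigma> \<subset> \<rho> \<Longrightarrow> \<rho> = \<tau>" "\<sigma> \<subset> \<tau>" "D = C - {\<sigma>, \<tau>}"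
    using assms(1) unfolding elementary_collapse_def free_face_def by blast
  show ?thesis
    unfolding simplicial_complex_def
  proof (intro conjI ballI allI impI)
    fix A B assume A: "A \<in> D" and B: "B \<noteq> {} \<and> B \<subseteq> A"
    then have "B \<in> C" using f(3) assms(2) unfolding simplicial_complex_def by blast
    moreover have "\<not> \<sigma> \<subseteq> A" using A f by blast
    ultimately show "B \<in> D" using B f(2,3) by blast
  qed (use assms(2) f(3) in \<open>auto simp: simplicial_complex_def\<close>)
qed

lemma big_free_collapse_elementary:
  assumes "big_free_collapse m C D" "1 \<le> m"
  shows "elementary_collapse (C - {{}}) (D - {{}})"
proof -
  obtain \<sigma> \<tau> where f: "free_face C \<sigma> \<tau>" "m \<le> card \<sigma>" "D = C - {\<sigma>, \<tau>}"
    using assms(1) unfolding big_free_collapse_def by blast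
  have "\<sigma> \<noteq> {}" using f(2) assms(2) by auto
  then have "free_face (C - {{}}) \<sigma> \<tau>" using f(1) unfolding free_face_def by blast
  moreover have "D - {{}} = (C - {{}}) - {\<sigma>, \<tau>}" using f(3) by blast
  ultimately show ?thesis unfolding elementary_collapse_def by blast
qed

lemma collapses_to_card_imp_collapses_onto_dim:
  assumes "collapses_to_card m C" and m: "1 \<le> m" and sc: "simplicial_complex (C - {{}})"
  shows "collapses_onto_dim (C - {{}}) (int m - 1)"
proof -
  obtain D where D: "(big_free_collapse m)\<^sup>*\<^sup>* C D" "\<forall>\<sigma>\<in>D. card \<sigma> \<le> m"
    using assms(1) unfolding collapses_to_card_def by blast
  have "elementary_collapse\<^sup>*\<^sup>* (C - {{}}) (D - {{}}) \<and> simplicial_complex (D - {{}})"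
    using D(1)
  proof (induction rule: rtranclp_induct)
    case (step D E)
    have "elementary_collapse (D - {{}}) (E - {{}})"
      using step.hyps(2) m by (rule big_free_collapse_elementary)
    then show ?case using step.IH simplicial_complex_elementary_collapse
      by (meson rtranclp.rtrancl_into_rtrancl)
  qed (use sc in simp)
  moreover have "\<forall>\<sigma>\<in>D - {{}}. face_dim \<sigma> \<le> int m - 1"
    using D(2) unfolding face_dim_def by fastforce
  ultimately show ?thesis unfolding collapses_onto_dim_def by blast
qed

lemma locally_sparse_hull_collapses:
  assumes "finite H" and fin: "\<And>e. e \<in> H \<Longrightarrow> finite e \<and> e \<noteq> {}"
    and s: "locally_sparse \<epsilon> N (nat (l + 1)) H" and "0 < \<epsilon>"
    and N: "real (nat (l + 1)) \<le> \<epsilon> * (real N - 1)" "1 \<le> N"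
  shows "collapses_onto_dim (simplicial_complex hull H) l"
proof (cases "0 \<le> l")
  case True
  have h: "simplicial_complex (simplicial_complex hull H)"
    using hull_simplicial_complex[OF fin] simplicial_complex_down_closure[OF fin] by simp
  have "collapses_to_card (nat (l + 1)) (down_closure H)"
    using assms True by (intro locally_sparse_collapses) auto
  then have "collapses_onto_dim (down_closure H - {{}}) (int (nat (l + 1)) - 1)"
    using True h hull_simplicial_complex[OF fin]
    by (intro collapses_to_card_imp_collapses_onto_dim) auto
  then show ?thesis using True hull_simplicial_complex[OF fin] by simp
next
  case False
  \<comment> \<open>For negative \<open>l\<close> the threshold \<open>nat (l + 1)\<close> is 0, and
    sparsity of a single edge would read \<open>0 < card e - card e\<close>.\<close>
  have "H = {}"
  proof (rule ccontr)
    assume "H \<noteq> {}"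
    then obtain e where "e \<in> H" by blast
    moreover from this have "0 < card e" using fin by (simp add: card_gt_0_iff)
    ultimately show False
      using s N(2) False unfolding locally_sparse_def by (auto dest!: spec[of _ "{e}"])
  qed
  then have "simplicial_complex hull H = {}"
    using hull_simplicial_complex[of H] by (simp add: down_closure_def)
  then show ?thesis
    unfolding collapses_onto_dim_def by (auto simp: simplicial_complex_def)
qed

subsection \<open>Local sparsity of the random hypergraph\<close>

lemma finite_possible_faces: "finite (possible_faces n)"
  by (rule finite_subset[of _ "Pow {..<n}"]) (auto simp: possible_faces_def)

lemma possible_faces_card: "\<sigma> \<in> possible_faces n \<Longrightarrow> 2 \<le> card \<sigma> \<and> nat (face_dim \<sigma>) = card \<sigma> - 1"
  by (auto simp: possible_faces_def face_dim_def)

lemma possible_faces_finite: "\<sigma> \<in> possible_faces n \<Longrightarrow> finite \<sigma>"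
  by (auto simp: possible_faces_def intro: finite_subset)

lemma set_random_hypergraph:
  assumes H: "H \<in> set_pmf (random_hypergraph n p)" and p: "\<And>i. 1 \<le> i \<Longrightarrow> 0 \<le> p i \<and> p i \<le> 1"
  shows "H \<subseteq> possible_faces n" and "\<sigma> \<in> H \<Longrightarrow> p (card \<sigma> - 1) \<noteq> 0"
proof -
  obtain f where f: "H = {\<sigma> \<in> possible_faces n. f \<sigma>}"
    "f \<in> PiE_dflt (possible_faces n) False (set_pmf \<circ> (\<lambda>\<sigma>. bernoulli_pmf (p (nat (face_dim \<sigma>)))))"
    using H unfolding random_hypergraph_def by (auto simp: set_Pi_pmf[OF finite_possible_faces])
  show "H \<subseteq> possible_faces n" using f(1) by blast
  assume "\<sigma> \<in> H"
  then have s: "\<sigma> \<in> possible_faces n" "f \<sigma>" using f(1) by auto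
  have "f \<sigma> \<in> set_pmf (bernoulli_pmf (p (card \<sigma> - 1)))"
    using f(2) s(1) possible_faces_card[OF s(1)] by (auto simp: PiE_dflt_def)
  moreover have "0 \<le> p (card \<sigma> - 1) \<and> p (card \<sigma> - 1) \<le> 1"
    using p possible_faces_card[OF s(1)] by auto
  ultimately show "p (card \<sigma> - 1) \<noteq> 0" using s(2) by (auto simp: set_pmf_iff)
qed

text \<open>The event is a box in the product space: coordinates in \<open>T\<close> are fixed to
  \<open>True\<close>, and the others contribute a factor 1.\<close>

lemma prob_subset_random_hypergraph:
  assumes T: "T \<subseteq> possible_faces n" and p: "\<And>i. 1 \<le> i \<Longrightarrow> 0 \<le> p i \<and> p i \<le> 1"
  shows "measure_pmf.prob (random_hypergraph n p) {H. T \<subseteq> H} = (\<Prod>\<sigma>\<in>T. p (card \<sigma> - 1))"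
proof -
  let ?A = "possible_faces n" and ?q = "\<lambda>\<sigma>. bernoulli_pmf (p (nat (face_dim \<sigma>)))"
  let ?B = "\<lambda>\<sigma>. if \<sigma> \<in> T then {True} else UNIV"
  have "(\<lambda>chosen. {\<sigma> \<in> ?A. chosen \<sigma>}) -` {H. T \<subseteq> H} = Pi ?A ?B"
    using T by (auto simp: Pi_def)
  then have "measure_pmf.prob (random_hypergraph n p) {H. T \<subseteq> H} =
      measure_pmf.prob (Pi_pmf ?A False ?q) (Pi ?A ?B)"
    unfolding random_hypergraph_def by simp
  also have "\<dots> = (\<Prod>\<sigma>\<in>?A. measure_pmf.prob (?q \<sigma>) (?B \<sigma>))"
    by (rule measure_Pi_pmf_Pi[OF finite_possible_faces])
  also have "\<dots> = (\<Prod>\<sigma>\<in>T. measure_pmf.prob (?q \<sigma>) (?B \<sigma>))"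
    using T finite_possible_faces by (intro prod.mono_neutral_right) auto
  also have "\<dots> = (\<Prod>\<sigma>\<in>T. p (card \<sigma> - 1))"
  proof (rule prod.cong)
    fix \<sigma> assume s: "\<sigma> \<in> T"
    then have c: "2 \<le> card \<sigma>" "nat (face_dim \<sigma>) = card \<sigma> - 1"
      using possible_faces_card[of \<sigma> n] T by auto
    have "0 \<le> p (card \<sigma> - 1) \<and> p (card \<sigma> - 1) \<le> 1" using c by (intro p) simp
    then show "measure_pmf.prob (?q \<sigma>) (?B \<sigma>) = p (card \<sigma> - 1)"
      using s c(2) by (simp add: measure_pmf_single)
  qed simp
  finally show ?thesis .
qed

text \<open>First moment method: a vertex set \<open>W\<close> spans a violating family with probability at most
  a constant times \<open>n powr - (card W + \<epsilon>)\<close>.\<close>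

lemma prob_not_locally_sparse_le:
  fixes p :: "nat \<Rightarrow> real" and \<epsilon> :: real and m n N r :: nat
  defines "B \<equiv> N * (r + 1)"
  assumes n: "1 \<le> n" and \<epsilon>: "0 < \<epsilon>" and p: "\<And>i. 1 \<le> i \<Longrightarrow> 0 \<le> p i \<and> p i \<le> 1"
    and pr: "\<And>i. r < i \<Longrightarrow> p i = 0"
    and pb: "\<And>i. 1 \<le> i \<Longrightarrow> p i \<le> real n powr (- (real i + 1 - real m + \<epsilon>))"
  shows "measure_pmf.prob (random_hypergraph n p) {H. \<not> locally_sparse \<epsilon> N m H}
      \<le> real ((B + 1) * 2 ^ 2 ^ B) * real n powr (- \<epsilon>)"
proof -
  let ?P = "measure_pmf.prob (random_hypergraph n p)"
  let ?w = "\<lambda>T. \<Sum>e\<in>T. real (card e) - real m + \<epsilon>"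
  define \<V> where "\<V> = {W. W \<subseteq> {..<n} \<and> card W \<le> B}"
  \<comment> \<open>These are the potential violations, with \<epsilon> moved into the edge weights.
    Only the size of the covered vertex set is bounded; \<open>B\<close> suffices because at most
    \<open>N\<close> edges with at most \<open>r + 1\<close> vertices each are involved.\<close>
  define \<T> where "\<T> = {T. T \<subseteq> possible_faces n \<and> \<Union>T \<in> \<V> \<and> real (card (\<Union>T)) + \<epsilon> \<le> ?w T}"
  have fin\<V>: "finite \<V>" unfolding \<V>_def by simp
  have fin\<T>: "finite \<T>" unfolding \<T>_def using finite_possible_faces by simp
  have bound: "?P {H. T \<subseteq> H} \<le> real n powr (- (real (card (\<Union>T)) + \<epsilon>))" if T: "T \<in> \<T>" for T
  proof -
    have "?P {H. T \<subseteq> H} = (\<Prod>e\<in>T. p (card e - 1))"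
      using T p unfolding \<T>_def by (intro prob_subset_random_hypergraph) auto
    also have "\<dots> \<le> (\<Prod>e\<in>T. real n powr (- (real (card e) - real m + \<epsilon>)))"
    proof (rule prod_mono)
      fix e assume "e \<in> T"
      then have c: "2 \<le> card e" using T possible_faces_card unfolding \<T>_def by blast
      then have "real (card e - 1) + 1 = real (card e)" by simp
      then show "0 \<le> p (card e - 1) \<and> p (card e - 1) \<le> real n powr (- (real (card e) - real m + \<epsilon>))"
        using p[of "card e - 1"] pb[of "card e - 1"] c by simp
    qed
    also have "\<dots> = real n powr (- ?w T)"
      using n unfolding sum_negf[symmetric] by (subst powr_sum) auto
    also have "\<dots> \<le> real n powr (- (real (card (\<Union>T)) + \<epsilon>))"
      using T n unfolding \<T>_def by (intro powr_mono) auto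
    finally show ?thesis .
  qed
  have "?P {H. \<not> locally_sparse \<epsilon> N m H} \<le> ?P (\<Union>T\<in>\<T>. {H. T \<subseteq> H})"
  proof (rule measure_pmf.finite_measure_mono_AE)
    show "AE H in random_hypergraph n p. H \<in> {H. \<not> locally_sparse \<epsilon> N m H} \<longrightarrow> H \<in> (\<Union>T\<in>\<T>. {H. T \<subseteq> H})"
      unfolding AE_measure_pmf_iff
    proof (intro ballI impI)
      fix H assume H: "H \<in> set_pmf (random_hypergraph n p)" and "H \<in> {H. \<not> locally_sparse \<epsilon> N m H}"
      then obtain T where T: "T \<subseteq> H" "T \<noteq> {}" "card T \<le> N"
        "real (card (\<Union>T)) - (\<Sum>e\<in>T. real (card e) - real m) \<le> \<epsilon> * (real (card T) - 1)"
        unfolding locally_sparse_def by (auto simp: not_less)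
      have HT: "T \<subseteq> possible_faces n" using set_random_hypergraph(1)[OF H p] T(1) by blast
      then have finT: "finite T" using finite_possible_faces finite_subset by blast
      have "card e \<le> r + 1" if "e \<in> T" for e
      proof -
        have "p (card e - 1) \<noteq> 0" using set_random_hypergraph(2)[OF H p] T(1) that by blast
        then show ?thesis using pr[of "card e - 1"] by linarith
      qed
      then have "(\<Sum>e\<in>T. card e) \<le> card T * (r + 1)"
        using sum_bounded_above[of T card "r + 1"] by simp
      moreover have "card (\<Union>T) \<le> (\<Sum>e\<in>T. card e)"
        using card_UN_le[OF finT, of "\<lambda>e. e"] by simp
      moreover have "card T * (r + 1) \<le> B" unfolding B_def using T(3) by (rule mult_right_mono) simp
      ultimately have "card (\<Union>T) \<le> B" by linarith
      moreover have "\<Union>T \<subseteq> {..<n}" using HT unfolding possible_faces_def by blast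
      moreover have "?w T = (\<Sum>e\<in>T. real (card e) - real m) + \<epsilon> * real (card T)"
        by (simp add: sum.distrib mult.commute)
      then have "real (card (\<Union>T)) + \<epsilon> \<le> ?w T" using T(4) by (simp add: algebra_simps)
      ultimately have "T \<in> \<T>" using HT unfolding \<T>_def \<V>_def by blast
      then show "H \<in> (\<Union>T\<in>\<T>. {H. T \<subseteq> H})" using T(1) by blast
    qed
  qed simp
  also have "\<dots> \<le> (\<Sum>T\<in>\<T>. ?P {H. T \<subseteq> H})"
    by (rule measure_pmf.finite_measure_subadditive_finite[OF fin\<T>]) simp
  also have "\<dots> \<le> (\<Sum>T\<in>\<T>. real n powr (- (real (card (\<Union>T)) + \<epsilon>)))"
    by (intro sum_mono bound)
  \<comment> \<open>Grouping by the covered set \<open>W\<close>: there are at most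
    \<open>2 ^ 2 ^ B\<close> families of subsets of \<open>W\<close>.\<close>
  also have "\<dots> = (\<Sum>W\<in>\<V>. \<Sum>T\<in>{T \<in> \<T>. \<Union>T = W}. real n powr (- (real (card (\<Union>T)) + \<epsilon>)))"
    by (rule sum.group[OF fin\<T> fin\<V>, symmetric]) (auto simp: \<T>_def)
  also have "\<dots> \<le> (\<Sum>W\<in>\<V>. real (2 ^ 2 ^ B) * real n powr (- (real (card W) + \<epsilon>)))"
  proof (rule sum_mono)
    fix W assume W: "W \<in> \<V>"
    then have finW: "finite W" unfolding \<V>_def by (auto intro: finite_subset)
    have "card {T \<in> \<T>. \<Union>T = W} \<le> card (Pow (Pow W))"
      using finW by (intro card_mono) auto
    also have "\<dots> = 2 ^ 2 ^ card W" using finW by (simp add: card_Pow)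
    also have "\<dots> \<le> 2 ^ 2 ^ B" using W unfolding \<V>_def by (intro power_increasing) auto
    finally have "real (card {T \<in> \<T>. \<Union>T = W}) \<le> real (2 ^ 2 ^ B)" by (simp only: of_nat_le_iff)
    then have "real (card {T \<in> \<T>. \<Union>T = W}) * real n powr (- (real (card W) + \<epsilon>))
        \<le> real (2 ^ 2 ^ B) * real n powr (- (real (card W) + \<epsilon>))"
      by (rule mult_right_mono) simp
    then show "(\<Sum>T\<in>{T \<in> \<T>. \<Union>T = W}. real n powr (- (real (card (\<Union>T)) + \<epsilon>)))
        \<le> real (2 ^ 2 ^ B) * real n powr (- (real (card W) + \<epsilon>))" by simp
  qed
  \<comment> \<open>Grouping by \<open>k = card W\<close>: the at most \<open>n ^ k\<close> choices
    of \<open>W\<close> cancel the factor \<open>n powr - k\<close>, leaving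
    \<open>n powr - \<epsilon>\<close> for each of the \<open>B + 1\<close> values of
    \<open>k\<close>.\<close>
  also have "\<dots> = (\<Sum>k\<le>B. \<Sum>W\<in>{W \<in> \<V>. card W = k}. real (2 ^ 2 ^ B) * real n powr (- (real (card W) + \<epsilon>)))"
    by (rule sum.group[OF fin\<V>, symmetric]) (auto simp: \<V>_def)
  also have "\<dots> \<le> (\<Sum>k\<le>B. real (2 ^ 2 ^ B) * real n powr (- \<epsilon>))"
  proof (rule sum_mono)
    fix k
    have "card {W \<in> \<V>. card W = k} \<le> card {W. W \<subseteq> {..<n} \<and> card W = k}"
      by (intro card_mono) (auto simp: \<V>_def)
    also have "\<dots> = n choose k" by (simp add: n_subsets)
    also have "\<dots> \<le> n ^ k" by (cases "k \<le> n") (auto simp: binomial_le_pow binomial_eq_0)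
    finally have c: "real (card {W \<in> \<V>. card W = k}) \<le> real n powr real k"
      using n by (simp add: powr_realpow flip: of_nat_power)
    have "(\<Sum>W\<in>{W \<in> \<V>. card W = k}. real (2 ^ 2 ^ B) * real n powr (- (real (card W) + \<epsilon>)))
        = real (card {W \<in> \<V>. card W = k}) * (real (2 ^ 2 ^ B) * real n powr (- (real k + \<epsilon>)))"
      by simp
    also have "\<dots> \<le> real n powr real k * (real (2 ^ 2 ^ B) * real n powr (- (real k + \<epsilon>)))"
      using c by (rule mult_right_mono) simp
    also have "\<dots> = real (2 ^ 2 ^ B) * real n powr (- \<epsilon>)"
      by (simp flip: powr_add add: mult.left_commute)
    finally show "(\<Sum>W\<in>{W \<in> \<V>. card W = k}. real (2 ^ 2 ^ B) * real n powr (- (real (card W) + \<epsilon>)))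
        \<le> real (2 ^ 2 ^ B) * real n powr (- \<epsilon>)" .
  qed
  also have "\<dots> = real ((B + 1) * 2 ^ 2 ^ B) * real n powr (- \<epsilon>)"
    by (simp add: algebra_simps)
  finally show ?thesis .
qed

section \<open>Choice of constants and passage to the limit\<close>

theorem theorem1p6:
  fixes p :: "nat \<Rightarrow> nat \<Rightarrow> real" and \<alpha> :: "nat \<Rightarrow> real" and I :: "nat set" and r :: nat
  assumes "I \<subseteq> {1..r}" and "I \<noteq> {}"
    and "\<And>i. i \<in> I \<Longrightarrow> \<alpha> i \<ge> 0"
    and "\<And>n i. n \<ge> 1 \<Longrightarrow> i \<in> I \<Longrightarrow> p n i = real n powr (- \<alpha> i)"
    and "\<And>n i. n \<ge> 1 \<Longrightarrow> i \<ge> 1 \<Longrightarrow> i \<notin> I \<Longrightarrow> p n i = 0"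
  shows "asymptotically_almost_surely (\<lambda>n. upper_complex n (p n))
           (\<lambda>X. collapses_onto_dim X \<lfloor>MAX i\<in>I. real i + 1 - \<alpha> i\<rfloor>)"
proof -
  define M where "M = (MAX i\<in>I. real i + 1 - \<alpha> i)"
  \<comment> \<open>\<open>m\<close> is the number of vertices of an \<open>l\<close>-face,
    truncated at 0 for negative \<open>l\<close>. In either case it exceeds \<open>M\<close>, and
    the gap \<epsilon> is the exponent of the failure probability; \<open>N\<close> is chosen so
    that \<open>real m \<le> \<epsilon> * (real N - 1)\<close>.\<close>
  define m where "m = nat (\<lfloor>M\<rfloor> + 1)"
  define \<epsilon> where "\<epsilon> = real m - M"
  define N where "N = nat \<lceil>real m / \<epsilon>\<rceil> + 1"
  define C where "C = real ((N * (r + 1) + 1) * 2 ^ 2 ^ (N * (r + 1)))"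
  have finI: "finite I" using assms(1) finite_subset by blast
  have \<epsilon>: "0 < \<epsilon>" unfolding \<epsilon>_def m_def by linarith
  have N: "real m \<le> \<epsilon> * (real N - 1)" "1 \<le> N"
  proof -
    have "real m / \<epsilon> \<le> real N - 1" unfolding N_def by linarith
    then show "real m \<le> \<epsilon> * (real N - 1)" using \<epsilon> by (simp add: field_simps)
  qed (simp add: N_def)
  have p01: "0 \<le> p n i \<and> p n i \<le> 1" if n: "1 \<le> n" and i: "1 \<le> i" for n i
  proof (cases "i \<in> I")
    case True
    then have "real n powr (- \<alpha> i) \<le> real n powr 0"
      using assms(3)[OF True] n by (intro powr_mono) auto
    then show ?thesis using assms(4)[OF n True] n by simp
  qed (use assms(5)[OF n i] in simp)
  \<comment> \<open>Maximality of \<open>M\<close> gives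
    \<open>\<alpha> i \<ge> real i + 1 - M\<close>, and \<open>M\<close> equals
    \<open>real m - \<epsilon>\<close>.\<close>
  have pb: "p n i \<le> real n powr (- (real i + 1 - real m + \<epsilon>))" if n: "1 \<le> n" and i: "1 \<le> i" for n i
  proof (cases "i \<in> I")
    case True
    then have "real i + 1 - \<alpha> i \<le> M" unfolding M_def using finI by (intro Max_ge) auto
    then show ?thesis using assms(4)[OF n True] n unfolding \<epsilon>_def by (auto intro!: powr_mono)
  qed (use assms(5)[OF n i] in simp)
  have lower: "1 - C * real n powr (- \<epsilon>)
      \<le> measure_pmf.prob (upper_complex n (p n)) {X. collapses_onto_dim X \<lfloor>M\<rfloor>}" if n: "1 \<le> n" for n
  proof -
    let ?P = "measure_pmf.prob (random_hypergraph n (p n))"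
    have "p n i = 0" if "r < i" for i using assms(1) assms(5)[OF n, of i] that by fastforce
    then have "?P {H. \<not> locally_sparse \<epsilon> N m H} \<le> C * real n powr (- \<epsilon>)"
      unfolding C_def using p01[OF n] pb[OF n] \<epsilon> n by (intro prob_not_locally_sparse_le) auto
    moreover have "?P {H. \<not> locally_sparse \<epsilon> N m H} = 1 - ?P {H. locally_sparse \<epsilon> N m H}"
      using measure_pmf.prob_compl[of "{H. locally_sparse \<epsilon> N m H}" "random_hypergraph n (p n)"]
      by (simp add: Compl_eq_Diff_UNIV[symmetric] Collect_neg_eq)
    moreover have "?P {H. locally_sparse \<epsilon> N m H}
        \<le> ?P {H. collapses_onto_dim (simplicial_complex hull H) \<lfloor>M\<rfloor>}"
    proof (rule measure_pmf.finite_measure_mono_AE)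
      show "AE H in random_hypergraph n (p n). H \<in> {H. locally_sparse \<epsilon> N m H} \<longrightarrow>
          H \<in> {H. collapses_onto_dim (simplicial_complex hull H) \<lfloor>M\<rfloor>}"
        unfolding AE_measure_pmf_iff
      proof (intro ballI impI)
        fix H assume H: "H \<in> set_pmf (random_hypergraph n (p n))"
          and s: "H \<in> {H. locally_sparse \<epsilon> N m H}"
        have Hp: "H \<subseteq> possible_faces n" using set_random_hypergraph(1)[OF H p01[OF n]] .
        have "finite e \<and> e \<noteq> {}" if "e \<in> H" for e
          using that Hp possible_faces_finite possible_faces_card by fastforce
        moreover have "finite H" using Hp finite_possible_faces finite_subset by blast
        ultimately show "H \<in> {H. collapses_onto_dim (simplicial_complex hull H) \<lfloor>M\<rfloor>}"
          using s \<epsilon> N locally_sparse_hull_collapses[of H \<epsilon> N "\<lfloor>M\<rfloor>"] unfolding m_def by simp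
      qed
    qed simp
    ultimately show ?thesis unfolding upper_complex_def by (simp add: vimage_def)
  qed
  have "(\<lambda>n. C * real n powr (- \<epsilon>)) \<longlonglongrightarrow> C * 0"
    using \<epsilon> by (intro tendsto_mult tendsto_const tendsto_neg_powr filterlim_real_sequentially) auto
  then have lim: "(\<lambda>n. 1 - C * real n powr (- \<epsilon>)) \<longlonglongrightarrow> 1"
    using tendsto_diff[OF tendsto_const[of 1]] by fastforce
  show ?thesis
    unfolding asymptotically_almost_surely_def M_def[symmetric]
  proof (rule tendsto_sandwich[OF _ _ lim tendsto_const])
    show "\<forall>\<^sub>F n in sequentially. 1 - C * real n powr (- \<epsilon>)
        \<le> measure_pmf.prob (upper_complex n (p n)) {X. collapses_onto_dim X \<lfloor>M\<rfloor>}"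
      using eventually_ge_at_top[of 1] by eventually_elim (rule lower)
  qed simp
qed

end
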